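(* Let $G$ be a Candy Nim game containing $p$ nonempty piles (where $p\ge1$) with no duplicate piles, i.e. the pile sizes are pairwise distinct. Then $N_W(G) \ge p-1$.
   Context: Candy Nim is played with the positions and moves of Nim: a position (game) $[a_1,\dots,a_p]$ consists of $p$ piles with $a_i$ candies, and in a move a player removes a positive number of candies from one pile. Players alternate; the player taking the last candy wins. A position is a $\mathcal{P}$ position if the bitwise XOR (nim-sum) $a_1\oplus\cdots\oplus a_p$ is $0$ (the player to move loses the underlying Nim game), and an $\mathcal{N}$ position otherwise. The losing player is called Luca and the winning player Windsor: in a $\mathcal{P}$ position it is Luca's turn, in an $\mathcal{N}$ position it is Windsor's turn. Luca may make any move; Windsor is forced to make winning Nim moves, i.e. each of his moves must lead to a $\mathcal{P}$ position. Subject to this, each player tries to collect as many candies as possible. For a position $G$, $N_L(G)$ and $N_W(G)$ are the numbers of candies collected by Luca and Windsor under optimal play (minimax). *)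

theory Defs
  imports Main "HOL-Library.Multiset"
begin

text \<open>
  A position is the multiset of its pile sizes. Empty piles (elements \<open>0\<close>) may occur: a pile
  that has been emptied stays in the position, and it admits no further move.
\<close>

type_synonym position = "nat multiset"

definition nonempty_piles :: "position \<Rightarrow> position" where
  "nonempty_piles G = {#a \<in># G. a > 0#}"

definition nim_sum :: "position \<Rightarrow> nat" where
  "nim_sum G = fold_mset xor 0 G"

definition P_position :: "position \<Rightarrow> bool" where
  "P_position G \<longleftrightarrow> nim_sum G = 0"

text \<open>A move \<open>(a, b)\<close> reduces a pile of size \<open>a\<close> to size \<open>b\<close>; the mover collects \<open>a - b\<close> candies.\<close>

definition moves :: "position \<Rightarrow> (nat \<times> nat) set" where
  "moves G = {(a, b). a \<in># G \<and> b < a}"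

definition move :: "position \<Rightarrow> nat \<times> nat \<Rightarrow> position" where
  "move G m = add_mset (snd m) (G - {#fst m#})"

definition gain :: "nat \<times> nat \<Rightarrow> nat" where
  "gain m = fst m - snd m"

definition winning_moves :: "position \<Rightarrow> (nat \<times> nat) set" where
  "winning_moves G = {m \<in> moves G. P_position (move G m)}"

lemma sum_mset_move:
  assumes "m \<in> moves G"
  shows "sum_mset (move G m) + gain m = sum_mset G" and "gain m > 0"
proof -
  obtain a b where m: "m = (a, b)" "a \<in># G" "b < a"
    using assms by (auto simp: moves_def)
  then obtain H where "G = add_mset a H"
    by (meson multi_member_split)
  with m show "sum_mset (move G m) + gain m = sum_mset G" and "gain m > 0"
    by (simp_all add: move_def gain_def)
qed

lemma move_decreases: "m \<in> moves G \<Longrightarrow> sum_mset (move G m) < sum_mset G"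
  using sum_mset_move[of m G] by linarith

text \<open>
  The minimax values. The total number of candies is fixed, so a player who maximises his own
  count minimises the count of his opponent. Luca is to move exactly in the \<open>\<P>\<close> positions, where
  he may make any move; Windsor is to move in the others, restricted to his winning moves.
  The sets under \<open>Max\<close> and \<open>Min\<close> are finite and nonempty (\<open>finite_moves\<close>,
  \<open>winning_moves_nonempty\<close>), and the two values add up to the number of candies
  (\<open>N_L_plus_N_W\<close>).
\<close>

function N_L :: "position \<Rightarrow> nat" where
  "N_L G =
    (if moves G = {} then 0
     else if P_position G then Max ((\<lambda>m. gain m + N_L (move G m)) ` moves G)
     else Min ((\<lambda>m. N_L (move G m)) ` winning_moves G))"
  by auto
termination
  by (relation "measure sum_mset") (auto simp: winning_moves_def move_decreases)

function N_W :: "position \<Rightarrow> nat" where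
  "N_W G =
    (if moves G = {} then 0
     else if P_position G then Min ((\<lambda>m. N_W (move G m)) ` moves G)
     else Max ((\<lambda>m. gain m + N_W (move G m)) ` winning_moves G))"
  by auto
termination
  by (relation "measure sum_mset") (auto simp: winning_moves_def move_decreases)

declare N_L.simps [simp del] N_W.simps [simp del]

lemma finite_moves: "finite (moves G)"
proof (rule finite_subset)
  show "moves G \<subseteq> (SIGMA a:set_mset G. {..<a})"
    by (auto simp: moves_def)
qed auto

lemma finite_winning_moves: "finite (winning_moves G)"
  by (simp add: winning_moves_def finite_moves)

lemma nim_sum_empty [simp]: "nim_sum {#} = 0"
  by (simp add: nim_sum_def)

lemma nim_sum_add_mset [simp]: "nim_sum (add_mset a G) = xor a (nim_sum G)"
proof -
  interpret comp_fun_commute "xor :: nat \<Rightarrow> nat \<Rightarrow> nat"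
    by standard (auto simp: fun_eq_iff xor.left_commute)
  show ?thesis by (simp add: nim_sum_def)
qed

lemma nat_less_if_bit:
  fixes a b :: nat
  assumes "bit a k" "\<not> bit b k" "\<And>j. j > k \<Longrightarrow> bit a j = bit b j"
  shows "b < a"
  using assms
proof (induction k arbitrary: a b)
  case 0
  have "a div 2 = b div 2"
    by (rule bit_eqI) (use "0.prems"(3) in \<open>simp flip: bit_Suc\<close>)
  with "0.prems"(1,2) show ?case
    by (simp add: bit_0) presburger
next
  case (Suc k)
  have "b div 2 < a div 2"
    by (rule Suc.IH) (use Suc.prems in \<open>simp_all flip: bit_Suc\<close>)
  then show ?case by linarith
qed

lemma nat_highest_bit:
  fixes s :: nat
  assumes "s \<noteq> 0"
  shows "\<exists>k. bit s k \<and> (\<forall>j>k. \<not> bit s j)"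
  using assms
proof (induction s rule: less_induct)
  case (less s)
  show ?case
  proof (cases "s = 1")
    case True
    have "bit s 0 \<and> (\<forall>j>0. \<not> bit s j)"
      unfolding True bit_1_iff by simp
    then show ?thesis by blast
  next
    case False
    with less.prems have "s div 2 \<noteq> 0" "s div 2 < s" by auto
    with less.IH obtain k where k: "bit (s div 2) k" "\<forall>j>k. \<not> bit (s div 2) j"
      by blast
    then have "bit s (Suc k)" "\<forall>j>Suc k. \<not> bit s j"
      by (auto simp: bit_Suc Suc_less_eq2)
    then show ?thesis by blast
  qed
qed

lemma bit_nim_sum_member: "bit (nim_sum G) k \<Longrightarrow> \<exists>a\<in>#G. bit a k"
  by (induction G) (auto simp: bit_xor_iff)

lemma winning_moves_nonempty:
  assumes "\<not> P_position G"
  shows "winning_moves G \<noteq> {}"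
proof -
  let ?s = "nim_sum G"
  from assms obtain k where k: "bit ?s k" "\<forall>j>k. \<not> bit ?s j"
    using nat_highest_bit by (auto simp: P_position_def)
  then obtain a where a: "a \<in># G" "bit a k"
    using bit_nim_sum_member by blast
  have "xor a ?s < a"
    by (rule nat_less_if_bit[of a k]) (use a k in \<open>auto simp: bit_xor_iff\<close>)
  moreover obtain H where H: "G = add_mset a H"
    using a(1) by (meson multi_member_split)
  have "nim_sum (move G (a, xor a ?s)) = 0"
    by (simp add: H move_def flip: xor.assoc)
  ultimately have "(a, xor a ?s) \<in> winning_moves G"
    using a(1) by (simp add: winning_moves_def moves_def P_position_def)
  then show ?thesis by blast
qed

lemma N_L_plus_N_W: "N_L G + N_W G = sum_mset G"
proof (induction "sum_mset G" arbitrary: G rule: less_induct)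
  case less
  have IH: "N_L (move G m) + N_W (move G m) + gain m = sum_mset G" if "m \<in> moves G" for m
    using less move_decreases[OF that] sum_mset_move[OF that] by simp
  have zero_sum: "Max ((\<lambda>m. gain m + f m) ` M) + Min (g ` M) = sum_mset G"
    if "finite M" "M \<noteq> {}" and fg: "\<And>m. m \<in> M \<Longrightarrow> f m + g m + gain m = sum_mset G"
    for M and f g :: "nat \<times> nat \<Rightarrow> nat"
  proof -
    have "Min (g ` M) \<in> g ` M"
      using that by (intro Min_in) auto
    then obtain m where m: "m \<in> M" "g m = Min (g ` M)"
      by auto
    have "Max ((\<lambda>m. gain m + f m) ` M) = gain m + f m"
    proof (rule Max_eqI)
      fix y assume "y \<in> (\<lambda>m. gain m + f m) ` M"
      then obtain n where n: "n \<in> M" "y = gain n + f n" by auto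
      have "g m \<le> g n"
        using m n \<open>finite M\<close> by simp
      then show "y \<le> gain m + f m"
        using fg[OF m(1)] fg[OF n(1)] n(2) by linarith
    qed (use that m in auto)
    then show ?thesis
      using fg[OF m(1)] m(2) by linarith
  qed
  show ?case
  proof (cases "moves G = {}")
    case True
    then have "\<forall>a\<in>#G. a = 0"
      unfolding moves_def by fastforce
    then have "sum_mset G = 0" by simp
    with True show ?thesis by (simp add: N_L.simps[of G] N_W.simps[of G])
  next
    case False
    show ?thesis
    proof (cases "P_position G")
      case True
      then show ?thesis
        using zero_sum[of "moves G" "\<lambda>m. N_L (move G m)" "\<lambda>m. N_W (move G m)"]
          False IH finite_moves
        by (simp add: N_L.simps[of G] N_W.simps[of G])
    next
      case not_P: False
      have IH': "N_W (move G m) + N_L (move G m) + gain m = sum_mset G"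
        if "m \<in> winning_moves G" for m
        using IH[of m] that by (simp add: winning_moves_def add.commute)
      show ?thesis
        using zero_sum[of "winning_moves G" "\<lambda>m. N_W (move G m)" "\<lambda>m. N_L (move G m)"]
          IH' False not_P finite_winning_moves winning_moves_nonempty[OF not_P]
        by (simp add: N_L.simps[of G] N_W.simps[of G] add.commute)
    qed
  qed
qed

end

theory Submission
  imports Defs
begin

text \<open>
  Windsor can treat a sum of \<open>\<P>\<close> positions as separate games and answer Luca in the component in
  which Luca moved, so \<open>N_W\<close> is superadditive on \<open>\<P>\<close> positions (\<open>N_W_superadditive\<close>). A pair of
  equal piles of size \<open>v\<close> is a \<open>\<P>\<close> position worth at least \<open>v\<close> to him (\<open>N_W_pair\<close>). Hence
  whenever a move produces a pile size that is already present, the two equal piles may be put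
  aside for \<open>v\<close> candies, and the remaining piles are pairwise distinct again (\<open>N_W_toggle\<close>).

  Play from a set of distinct piles thus stays among sets of distinct piles, and it suffices to
  watch the number \<open>d\<close> of distinct nonzero piles. In a round each player touches one pile. A
  pile reduced to a new nonzero size leaves \<open>d\<close> as it was; an emptied pile costs \<open>1\<close>; a pile
  reduced to a size \<open>v > 0\<close> already present costs \<open>2\<close> but secures \<open>v\<close> candies, which is a net loss
  only for \<open>v = 1\<close>. So a round costs at most \<open>2\<close>, and Windsor's winning move collects at least
  one candy. The balance is negative in one case only: Luca empties the pile \<open>3\<close>, and
  Windsor reduces \<open>2\<close> to \<open>1\<close> with another \<open>1\<close> present. This uses up the piles \<open>1\<close> and \<open>2\<close>, so it is
  absorbed by the sharper claim (\<open>N_W_distinct_P\<close>) that Windsor gets at least \<open>d\<close> candies from a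
  \<open>\<P>\<close> position of distinct piles, or \<open>d - 1\<close> if both \<open>1\<close> and \<open>2\<close> are among them.

  From an \<open>\<N>\<close> position, Windsor's first move is judged by the same count: it costs at most \<open>1\<close>,
  which the candies collected by it repay, and the \<open>\<P>\<close> position reached falls short by at most \<open>1\<close>.
\<close>

section \<open>Rounds of play\<close>

lemma move_add_mset [simp]: "move (add_mset a H) (a, b) = add_mset b H"
  by (simp add: move_def)

lemma moves_add_mset: "(a, b) \<in> moves (add_mset a H) \<longleftrightarrow> b < a"
  by (simp add: moves_def)

lemma moves_split:
  assumes "m \<in> moves G"
  obtains a b H where "m = (a, b)" "G = add_mset a H" "b < a"
  using assms by (auto simp: moves_def dest!: multi_member_split)

lemma nim_sum_union: "nim_sum (G + H) = xor (nim_sum G) (nim_sum H)"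
  by (induction G) (simp_all add: xor.assoc)

lemma P_position_union: "P_position G \<Longrightarrow> P_position (G + H) \<longleftrightarrow> P_position H"
  by (simp add: P_position_def nim_sum_union)

lemma xor_eq_0_iff: "xor a b = 0 \<longleftrightarrow> a = b" for a b :: nat
  by (metis xor.assoc xor.right_neutral xor_self_eq xor.left_neutral)

lemma P_position_add_mset: "P_position (add_mset a G) \<longleftrightarrow> a = nim_sum G"
  by (simp add: P_position_def xor_eq_0_iff)

lemma move_from_P:
  assumes "P_position G" "m \<in> moves G"
  shows "\<not> P_position (move G m)"
  using assms by (auto elim!: moves_split simp: P_position_add_mset)

lemma moves_if_not_P: "\<not> P_position G \<Longrightarrow> moves G \<noteq> {}"
  using winning_moves_nonempty by (auto simp: winning_moves_def)

lemma N_W_winning_move: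
  assumes "\<not> P_position G" "m \<in> winning_moves G"
  shows "gain m + N_W (move G m) \<le> N_W G"
  using assms finite_winning_moves moves_if_not_P by (subst (2) N_W.simps) auto

lemma N_W_round_obtain:
  assumes "P_position G" "m \<in> moves G"
  obtains w where "w \<in> winning_moves (move G m)"
    and "N_W G \<le> gain w + N_W (move (move G m) w)"
proof -
  let ?H = "move G m"
  have H: "\<not> P_position ?H"
    using assms by (rule move_from_P)
  have "N_W ?H = Max ((\<lambda>w. gain w + N_W (move ?H w)) ` winning_moves ?H)"
    using H moves_if_not_P by (subst N_W.simps) auto
  also have "\<dots> \<in> (\<lambda>w. gain w + N_W (move ?H w)) ` winning_moves ?H"
    using finite_winning_moves winning_moves_nonempty[OF H] by (intro Max_in) auto
  finally obtain w where w: "w \<in> winning_moves ?H" "N_W ?H = gain w + N_W (move ?H w)"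
    by auto
  have "N_W G = Min ((\<lambda>m. N_W (move G m)) ` moves G)"
    using assms by (subst N_W.simps) auto
  also have "\<dots> \<le> N_W ?H"
    using assms(2) finite_moves by simp
  finally show thesis
    using that w by simp
qed

lemma N_W_round_ge:
  assumes P: "P_position G" and nonempty: "moves G \<noteq> {}"
    and reply: "\<And>m. m \<in> moves G \<Longrightarrow>
      \<exists>w\<in>winning_moves (move G m). k \<le> gain w + N_W (move (move G m) w)"
  shows "k \<le> N_W G"
proof -
  have "k \<le> N_W (move G m)" if m: "m \<in> moves G" for m
    using reply[OF m] N_W_winning_move[OF move_from_P[OF P m]] order_trans by blast
  then show ?thesis
    using P nonempty finite_moves by (subst N_W.simps) simp
qed

section \<open>Superadditivity\<close>

lemma moves_union: "moves (G + H) = moves G \<union> moves H"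
  by (auto simp: moves_def)

lemma move_union: "m \<in> moves G \<Longrightarrow> move (G + H) m = move G m + H"
  by (erule moves_split) simp

text \<open>
  Windsor can play two \<open>\<P>\<close> positions side by side, always answering in the component that Luca
  has just moved in, with the reply that is optimal there.
\<close>

lemma N_W_superadditive:
  assumes "P_position G" "P_position H"
  shows "N_W G + N_W H \<le> N_W (G + H)"
  using assms
proof (induction "sum_mset (G + H)" arbitrary: G H rule: less_induct)
  case less
  have reply: "\<exists>w\<in>winning_moves (move (A + B) m).
      N_W A + N_W B \<le> gain w + N_W (move (move (A + B) m) w)"
    if A: "P_position A" and B: "P_position B" and m: "m \<in> moves A"
      and sum: "sum_mset (A + B) = sum_mset (G + H)" for A B m
  proof -
    obtain w where w: "w \<in> winning_moves (move A m)"
      and le: "N_W A \<le> gain w + N_W (move (move A m) w)"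
      using N_W_round_obtain[OF A m] by blast
    let ?A = "move (move A m) w"
    have w': "w \<in> moves (move A m)" "P_position ?A"
      using w by (auto simp: winning_moves_def)
    have "sum_mset ?A < sum_mset A"
      using move_decreases[OF w'(1)] move_decreases[OF m] by simp
    then have "N_W ?A + N_W B \<le> N_W (?A + B)"
      using less.hyps[of ?A B] w'(2) B sum by simp
    moreover have "move (move (A + B) m) w = ?A + B"
      using m w'(1) by (simp add: move_union)
    moreover have "w \<in> winning_moves (move (A + B) m)"
      using m w' B by (simp add: winning_moves_def move_union moves_union P_position_union)
    ultimately show ?thesis
      using le by force
  qed
  show ?case
  proof (cases "moves (G + H) = {}")
    case True
    then show ?thesis
      by (subst (1 2) N_W.simps) (auto simp: moves_union)
  next
    case False
    show ?thesis
    proof (rule N_W_round_ge)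
      show "P_position (G + H)"
        using less.prems by (simp add: P_position_union)
      fix m assume "m \<in> moves (G + H)"
      then consider "m \<in> moves G" | "m \<in> moves H"
        by (auto simp: moves_union)
      then show "\<exists>w\<in>winning_moves (move (G + H) m).
          N_W G + N_W H \<le> gain w + N_W (move (move (G + H) m) w)"
        by cases (use reply[of G H m] reply[of H G m] less.prems in \<open>simp_all add: add.commute\<close>)
    qed (rule False)
  qed
qed

text \<open>Windsor copies every move of Luca in the other pile.\<close>

lemma N_W_pair: "v \<le> N_W {#v, v#}"
proof (induction v rule: less_induct)
  case (less v)
  show ?case
  proof (cases "v = 0")
    case False
    show ?thesis
    proof (rule N_W_round_ge)
      show "P_position {#v, v#}"
        by (simp add: P_position_def)
      have "(v, 0) \<in> moves {#v, v#}"
        using False by (simp add: moves_def)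
      then show "moves {#v, v#} \<noteq> {}" by blast
      fix m assume "m \<in> moves {#v, v#}"
      then obtain u where m: "m = (v, u)" "u < v"
        by (auto simp: moves_def)
      have H: "move {#v, v#} m = {#v, u#}"
        by (simp add: m add_mset_commute)
      have "(v, u) \<in> winning_moves {#v, u#}"
        using m(2) by (simp add: winning_moves_def moves_add_mset P_position_def)
      moreover have "v \<le> gain (v, u) + N_W (move {#v, u#} (v, u))"
        using less[OF m(2)] m(2) by (simp add: gain_def)
      ultimately show "\<exists>w\<in>winning_moves (move {#v, v#} m).
          v \<le> gain w + N_W (move (move {#v, v#} m) w)"
        unfolding H by blast
    qed
  qed simp
qed

section \<open>Splitting off pairs of equal piles\<close>

text \<open>
  A position is considered up to pairs of equal piles, so it is represented by the set of sizes of
  odd multiplicity; adding a pile of size \<open>y\<close> toggles the membership of \<open>y\<close>. Empty piles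
  are subject to the same rule, and only the counting ignores \<open>0\<close>.
\<close>

definition toggle :: "nat \<Rightarrow> nat set \<Rightarrow> nat set" where
  "toggle y S = (if y \<in> S then S - {y} else insert y S)"

definition pair_value :: "nat \<Rightarrow> nat set \<Rightarrow> nat" where
  "pair_value y S = (if y \<in> S then y else 0)"

text \<open>
  The change of (number of distinct nonzero piles) + (candies secured by pairs) when a pile of
  size \<open>y\<close> joins the piles of \<open>S\<close>. It is never negative, and it vanishes only for \<open>y = 0\<close> and
  for \<open>y = 1 \<in> S\<close>.
\<close>

definition surplus :: "nat \<Rightarrow> nat set \<Rightarrow> nat" where
  "surplus y S = (if y = 0 then 0 else if y \<in> S then y - 1 else 1)"

lemma finite_toggle [simp]: "finite (toggle y S) \<longleftrightarrow> finite S"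
  by (simp add: toggle_def)

lemma card_toggle:
  assumes "finite S"
  shows "pair_value y S + card (toggle y S - {0}) = card (S - {0}) + surplus y S"
proof (cases "y = 0 \<or> y \<notin> S")
  case True
  then show ?thesis
    using assms by (auto simp: toggle_def pair_value_def surplus_def insert_Diff_if)
next
  case False
  then have "S - {0} = insert y (S - {y} - {0})" by auto
  then have "card (S - {0}) = Suc (card (S - {y} - {0}))"
    using assms by (metis card_insert_disjoint finite_Diff insertI1 Diff_iff)
  then show ?thesis
    using False by (simp add: toggle_def pair_value_def surplus_def)
qed

lemma N_W_toggle:
  assumes "finite S" and P: "P_position (add_mset y (mset_set S) + X)"
  shows "P_position (mset_set (toggle y S) + X)"
    and "pair_value y S + N_W (mset_set (toggle y S) + X) \<le> N_W (add_mset y (mset_set S) + X)"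
proof -
  let ?D = "mset_set (toggle y S) + X"
  have "P_position ?D \<and> pair_value y S + N_W ?D \<le> N_W (add_mset y (mset_set S) + X)"
  proof (cases "y \<in> S")
    case True
    have "mset_set S = add_mset y (mset_set (S - {y}))"
      using assms(1) True by (simp add: mset_set.remove)
    then have eq: "add_mset y (mset_set S) + X = {#y, y#} + ?D"
      using True by (simp add: toggle_def)
    have pair: "P_position {#y, y#}"
      by (simp add: P_position_def)
    then have D: "P_position ?D"
      using P unfolding eq by (simp only: P_position_union)
    show ?thesis
      using N_W_superadditive[OF pair D] N_W_pair[of y] D True
      unfolding eq by (simp add: pair_value_def)
  next
    case False
    then show ?thesis
      using assms by (simp add: toggle_def pair_value_def)
  qed
  then show "P_position ?D" "pair_value y S + N_W ?D \<le> N_W (add_mset y (mset_set S) + X)"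
    by blast+
qed

section \<open>Distinct piles\<close>

text \<open>
  The arithmetic of one round: Luca turns \<open>a\<close> into \<open>b\<close>, Windsor turns \<open>c\<close> into \<open>e\<close>, and \<open>S\<close> is the
  set of the other piles. Two distinct nonzero piles disappear, so Windsor's \<open>c - e\<close> candies and
  the two surpluses have to make up for \<open>2\<close>. They fall short of it only if
  \<open>c - e = 1\<close> and both surpluses vanish, which forces \<open>b = 0\<close>, \<open>e = 1 \<in> S\<close> and \<open>c = 2\<close>; then
  both \<open>1\<close> and \<open>2\<close> were present and \<open>1\<close> has gone. Conversely, if \<open>1\<close> and \<open>2\<close> become
  both present, then one of them has just been created, which leaves one candy to spare.
\<close>

lemma round_balance:
  fixes a b c e :: nat
  assumes "e < c" "b \<noteq> c" "b \<noteq> e" and xor: "xor a b = xor c e"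
    and S: "a \<notin> S" "c \<notin> S"
  shows "2 + of_bool (1 \<in> toggle e (toggle b S) \<and> 2 \<in> toggle e (toggle b S))
    \<le> (c - e) + surplus b S + surplus e S
      + of_bool (1 \<in> insert a (insert c S) \<and> 2 \<in> insert a (insert c S))"
proof -
  let ?D = "toggle e (toggle b S)" and ?R = "insert a (insert c S)"
  have mem: "x \<in> ?D \<longleftrightarrow> (x \<in> S) \<noteq> (x = b \<or> x = e)" for x
    using \<open>b \<noteq> e\<close> by (auto simp: toggle_def)
  have surplus: "surplus y S \<ge> 1" if "y \<noteq> 0" "y = 1 \<Longrightarrow> 1 \<notin> S" for y
    using that by (cases "y = 1") (auto simp: surplus_def)
  show ?thesis
  proof (cases "1 \<in> ?D \<and> 2 \<in> ?D")
    case False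
    show ?thesis
    proof (rule ccontr)
      assume "\<not> ?thesis"
      then have lt: "(c - e) + surplus b S + surplus e S + of_bool (1 \<in> ?R \<and> 2 \<in> ?R) < 2"
        using False by (auto simp only: of_bool_def if_False split: if_splits)
      then have "c = e + 1" "surplus b S = 0" "surplus e S = 0"
        using \<open>e < c\<close> by linarith+
      moreover from this surplus have "b = 0 \<or> b = 1 \<and> 1 \<in> S" "e = 0 \<or> e = 1 \<and> 1 \<in> S"
        by force+
      ultimately have "e = 1" "1 \<in> S" "c = 2"
        using \<open>b \<noteq> e\<close> \<open>b \<noteq> c\<close> by auto
      then show False
        using lt by simp
    qed
  next
    case True
    show ?thesis
    proof (rule ccontr)
      assume "\<not> ?thesis"
      then have lt: "(c - e) + surplus b S + surplus e S + of_bool (1 \<in> ?R \<and> 2 \<in> ?R) < 3"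
        using True by (auto simp only: of_bool_def simp_thms if_True split: if_splits)
      have S12: "1 \<in> S \<longleftrightarrow> b \<noteq> 1 \<and> e \<noteq> 1" "2 \<in> S \<longleftrightarrow> b \<noteq> 2 \<and> e \<noteq> 2"
        using True mem[of 1] mem[of 2] by auto
      have b: "surplus b S \<ge> 1" if "b \<noteq> 0"
        using surplus[OF that] S12(1) by blast
      have e: "surplus e S \<ge> 1" if "e \<noteq> 0"
        using surplus[OF that] S12(1) by blast
      from lt b e \<open>b \<noteq> e\<close> \<open>e < c\<close> consider "b = 0" "e \<noteq> 0" | "b \<noteq> 0" "e = 0"
        by linarith
      then show False
      proof cases
        case 1
        then have c: "c = e + 1" and R: "\<not> (1 \<in> ?R \<and> 2 \<in> ?R)"
          using lt e \<open>e < c\<close> by (auto split: if_splits)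
        have "e \<noteq> 1"
        proof
          assume "e = 1"
          then have "c = 2" using c by simp
          then have "2 \<notin> S" using S(2) by simp
          then show False using S12(2) 1 \<open>e = 1\<close> by simp
        qed
        then have "e = 2" "c = 3"
          using S12 1 R c by auto
        \<comment> \<open>Here \<open>2\<close> is created at the gain of a single candy while Luca empties a pile; the
          nim-sum shows that this pile was \<open>1\<close>.\<close>
        with xor 1 have "a = 1" by simp
        then show False
          using S12(1) 1 \<open>e \<noteq> 1\<close> S(1) by simp
      next
        case 2
        then have "c = 1"
          using lt b \<open>e < c\<close> by linarith
        then show False
          using S12(1) 2 \<open>b \<noteq> c\<close> S(2) by simp
      qed
    qed
  qed
qed

text \<open>
  The exception for \<open>1, 2 \<in> R\<close> cannot be dropped, as \<open>{1, 2, 3}\<close> shows, and it is what makes the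
  induction work: if one less than the number of nonzero piles were claimed for all \<open>R\<close>, the
  passage from the piles \<open>1, 2, 3\<close> and \<open>R'\<close> to \<open>1, 1\<close> and \<open>R'\<close> would lose one candy. Windsor may
  answer Luca's move on distinct piles with any winning move; \<open>round_balance\<close> covers them all.
\<close>

lemma N_W_distinct_P:
  assumes "finite R" "P_position (mset_set R)"
  shows "card (R - {0}) \<le> N_W (mset_set R) + of_bool (1 \<in> R \<and> 2 \<in> R)"
  using assms
proof (induction "sum_mset (mset_set R)" arbitrary: R rule: less_induct)
  case less
  note fin = \<open>finite R\<close>
  show ?case
  proof (cases "moves (mset_set R) = {}")
    case True
    have "x = 0" if "x \<in> R" for x
    proof (rule ccontr)
      assume "x \<noteq> 0"
      then have "(x, 0) \<in> moves (mset_set R)"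
        using that fin by (simp add: moves_def)
      with True show False by simp
    qed
    then have "R - {0} = {}" by auto
    then show ?thesis by (simp only: card.empty)
  next
    case False
    \<comment> \<open>Where the truncated subtraction cuts off, the claim is trivial.\<close>
    let ?k = "card (R - {0}) - of_bool (1 \<in> R \<and> 2 \<in> R)"
    have "?k \<le> N_W (mset_set R)"
    proof (rule N_W_round_ge)
      fix m assume m: "m \<in> moves (mset_set R)"
      then obtain a b where ab: "m = (a, b)" "a \<in> R" "b < a"
        using fin by (auto simp: moves_def)
      let ?H = "add_mset b (mset_set (R - {a}))"
      have R: "mset_set R = add_mset a (mset_set (R - {a}))"
        using fin ab(2) by (rule mset_set.remove)
      have H: "move (mset_set R) m = ?H"
        unfolding R by (simp add: ab(1))
      have notP: "\<not> P_position ?H"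
        using move_from_P[OF less.prems(2) m] unfolding H .
      have a: "a = nim_sum (mset_set (R - {a}))"
        using less.prems(2) unfolding R P_position_add_mset .
      obtain w where w: "w \<in> winning_moves ?H"
        using winning_moves_nonempty[OF notP] by blast
      obtain c e where ce: "w = (c, e)" "e < c" "c \<in># ?H"
        using w by (cases w) (auto simp: winning_moves_def moves_def)
      have P': "P_position (move ?H w)"
        using w by (simp add: winning_moves_def)
      \<comment> \<open>Moving a pile of size \<open>b\<close> again would have to restore \<open>a > b\<close>.\<close>
      have "c \<noteq> b"
      proof
        assume "c = b"
        then have "e = a"
          using P' a by (simp add: ce(1) P_position_add_mset)
        with \<open>c = b\<close> ce(2) ab(3) show False by simp
      qed
      then have c: "c \<in> R" "c \<noteq> a"
        using ce(3) fin by auto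
      define S where "S = R - {a, c}"
      have finS: "finite S" using fin by (simp add: S_def)
      have R': "R = insert a (insert c S)"
        using ab(2) c(1) by (auto simp: S_def)
      have S: "a \<notin> S" "c \<notin> S" by (auto simp: S_def)
      have Ra: "mset_set (R - {a}) = add_mset c (mset_set S)"
        using R' S c finS by (simp add: insert_Diff_if)
      have G': "move ?H w = add_mset b (mset_set S) + {#e#}"
        unfolding Ra ce(1) by (subst add_mset_commute) simp
      let ?T = "toggle b S"
      let ?D = "toggle e ?T"
      have T: "P_position (mset_set ?T + {#e#})"
        "pair_value b S + N_W (mset_set ?T + {#e#}) \<le> N_W (move ?H w)"
        using N_W_toggle[OF finS, of b "{#e#}"] P' unfolding G' by blast+
      have D: "P_position (mset_set ?D)"
        "pair_value e ?T + N_W (mset_set ?D) \<le> N_W (mset_set ?T + {#e#})"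
        using N_W_toggle[of ?T e "{#}"] T(1) finS by simp_all
      have xor: "xor a b = xor c e"
      proof -
        have "nim_sum (move ?H w) = 0" using P' by (simp add: P_position_def)
        then have "xor b (xor e (nim_sum (mset_set S))) = 0"
          unfolding G' by (simp add: xor.left_commute)
        moreover have "a = xor c (nim_sum (mset_set S))" using a unfolding Ra by simp
        ultimately show ?thesis
          by (metis xor.assoc xor.commute xor_eq_0_iff)
      qed
      have "b \<noteq> e"
      proof
        assume "b = e"
        then have "xor (xor a b) b = xor (xor c b) b" using xor by simp
        then show False using c(2) by (simp add: xor.assoc)
      qed
      have sum: "sum_mset (mset_set ?D) < sum_mset (mset_set R)"
      proof -
        have *: "sum_mset (mset_set (toggle y Q)) \<le> y + sum_mset (mset_set Q)" if "finite Q" for y Q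
          using that by (auto simp: toggle_def mset_set.remove)
        have "sum_mset (mset_set ?D) \<le> e + (b + sum_mset (mset_set S))"
          using *[of ?T e] *[of S b] finS by simp
        also have "\<dots> < c + (a + sum_mset (mset_set S))"
          using ab ce by simp
        also have "\<dots> = sum_mset (mset_set R)"
          using R Ra by simp
        finally show ?thesis .
      qed
      have IH: "card (?D - {0}) \<le> N_W (mset_set ?D) + of_bool (1 \<in> ?D \<and> 2 \<in> ?D)"
        using less.hyps[OF sum] finS D(1) by simp
      have cards: "card (R - {0}) = card (S - {0}) + 2"
        using R' S c finS ab ce by (simp add: insert_Diff_if)
      have "surplus e ?T = surplus e S"
        using \<open>b \<noteq> e\<close> by (auto simp: surplus_def toggle_def)
      then have "pair_value b S + pair_value e ?T + card (?D - {0})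
          = card (S - {0}) + surplus b S + surplus e S"
        using card_toggle[OF finS, of b] card_toggle[of ?T e] finS by simp
      moreover have "2 + of_bool (1 \<in> ?D \<and> 2 \<in> ?D)
          \<le> gain w + surplus b S + surplus e S + of_bool (1 \<in> R \<and> 2 \<in> R)"
        using round_balance[OF ce(2) _ \<open>b \<noteq> e\<close> xor S] \<open>c \<noteq> b\<close>
        unfolding R' ce(1) by (simp add: gain_def)
      ultimately have "?k \<le> gain w + N_W (move ?H w)"
        using IH T(2) D(2) cards by linarith
      then show "\<exists>w\<in>winning_moves (move (mset_set R) m).
          ?k \<le> gain w + N_W (move (move (mset_set R) m) w)"
        unfolding H using w by blast
    qed (use less.prems False in auto)
    then show ?thesis by linarith
  qed
qed

lemma distinct_piles_decompose:
  assumes "\<And>a. count (nonempty_piles G) a \<le> 1"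
  obtains R n where "finite R" "0 \<notin> R" "card R = size (nonempty_piles G)"
    "G = mset_set R + replicate_mset n 0"
proof
  let ?R = "set_mset (nonempty_piles G)"
  show "finite ?R" "0 \<notin> ?R"
    by (auto simp: nonempty_piles_def)
  have R: "mset_set ?R = nonempty_piles G"
  proof (rule multiset_eqI)
    fix a show "count (mset_set ?R) a = count (nonempty_piles G) a"
    proof (cases "a \<in># nonempty_piles G")
      case True
      then have "count (nonempty_piles G) a > 0" by simp
      with assms[of a] have "count (nonempty_piles G) a = 1" by linarith
      with True show ?thesis by simp
    next
      case False
      then show ?thesis by (simp add: not_in_iff)
    qed
  qed
  show "card ?R = size (nonempty_piles G)"
    by (metis R size_mset_set)
  show "G = mset_set ?R + replicate_mset (count G 0) 0"
    unfolding R by (rule multiset_eqI) (simp add: nonempty_piles_def)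
qed

theorem theorem6p9:
  fixes G :: position and p :: nat
  assumes "size (nonempty_piles G) = p" and "p \<ge> 1"
    and "\<And>a. count (nonempty_piles G) a \<le> 1"
  shows "N_W G \<ge> p - 1"
proof -
  obtain R n where R: "finite R" "0 \<notin> R" "card R = p" and G: "G = mset_set R + replicate_mset n 0"
    using distinct_piles_decompose[OF assms(3)] assms(1) by metis
  let ?Z = "replicate_mset n (0::nat)"
  have Z: "P_position ?Z"
    by (induction n) (simp_all add: P_position_def)
  have distinct: "card (D - {0}) \<le> N_W (mset_set D + ?Z) + 1"
    if "finite D" "P_position (mset_set D + ?Z)" for D
  proof -
    have D: "P_position (mset_set D)"
      using that(2) P_position_union[OF Z] by (simp add: add.commute)
    have "card (D - {0}) \<le> N_W (mset_set D) + 1"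
      using N_W_distinct_P[OF that(1) D] by (simp add: of_bool_def split: if_splits)
    then show ?thesis
      using N_W_superadditive[OF D Z] by linarith
  qed
  show ?thesis
  proof (cases "P_position G")
    case True
    then show ?thesis
      using distinct[of R] R G by simp
  next
    case False
    then obtain w where w: "w \<in> winning_moves G"
      using winning_moves_nonempty by blast
    obtain c e where ce: "w = (c, e)" "e < c" "c \<in># G"
      using w by (cases w) (auto simp: winning_moves_def moves_def)
    then have c: "c \<in> R"
      using G R(1) by (auto split: if_splits)
    let ?S = "R - {c}"
    have G': "move G w = add_mset e (mset_set ?S) + ?Z"
      using mset_set.remove[OF R(1) c] by (simp add: G ce(1))
    have P': "P_position (move G w)"
      using w by (simp add: winning_moves_def)
    have T: "P_position (mset_set (toggle e ?S) + ?Z)"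
      "pair_value e ?S + N_W (mset_set (toggle e ?S) + ?Z) \<le> N_W (move G w)"
      using N_W_toggle[of ?S e ?Z] P' R(1) unfolding G' by simp_all
    have "card (?S - {0}) = p - 1"
      using R c by simp
    then have "p - 1 \<le> pair_value e ?S + card (toggle e ?S - {0})"
      using card_toggle[of ?S e] R(1) by simp
    also have "\<dots> \<le> gain w + N_W (move G w)"
      using distinct[of "toggle e ?S"] T R(1) ce by (simp add: gain_def)
    also have "\<dots> \<le> N_W G"
      using N_W_winning_move[OF False w] .
    finally show ?thesis .
  qed
qed

end
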